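(* There is an algorithm (RecSmooth) which, given positive integers $p,q$ and an $m'\times n'$ integer matrix $A$ that is $(1,1)$-smooth, outputs an $m\times n$ binary matrix $M$ with $R_{p,q}(M)=A$, where $m=m'+p-1$ and $n=n'+q-1$, if such an $M$ exists, and returns FAILURE otherwise; and for all fixed $p$ and $q$ its running time is bounded by a polynomial in $m$ and $n$.
   Context: A binary matrix has entries in $\{0,1\}$. The $(p,q)$-rectangular scan of an $m\times n$ matrix $M$ (with $1\le p\le m$, $1\le q\le n$) is the $(m-p+1)\times(n-q+1)$ matrix $R_{p,q}(M)[i,j]=\sum_{r=0}^{p-1}\sum_{c=0}^{q-1}M[i+r,j+c]$. $A$ is $(1,1)$-smooth if $A[i,j]+A[i+1,j+1]-A[i+1,j]-A[i,j+1]=0$ whenever $1\le i\le m'-1$, $1\le j\le n'-1$. Time is counted in elementary operations (arithmetic operations and comparisons on integers have unit cost). *)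

theory Defs
  imports "Jordan_Normal_Form.Matrix" "HOL-Computational_Algebra.Polynomial"
begin

section \<open>Rectangular scans and smoothness\<close>

text \<open>Matrices are indexed from 0 here.\<close>

definition binary_mat :: "int mat \<Rightarrow> bool" where
  "binary_mat M \<longleftrightarrow> elements_mat M \<subseteq> {0, 1}"

text \<open>Only meaningful for \<open>1 \<le> p \<le> dim_row M\<close> and \<open>1 \<le> q \<le> dim_col M\<close>
  (truncated subtraction).\<close>

definition rect_scan :: "nat \<Rightarrow> nat \<Rightarrow> int mat \<Rightarrow> int mat" where
  "rect_scan p q M =
     mat (dim_row M - p + 1) (dim_col M - q + 1)
       (\<lambda>(i, j). \<Sum>r<p. \<Sum>c<q. M $$ (i + r, j + c))"

definition smooth11 :: "int mat \<Rightarrow> bool" where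
  "smooth11 A \<longleftrightarrow>
     (\<forall>i j. i + 1 < dim_row A \<longrightarrow> j + 1 < dim_col A \<longrightarrow>
        A $$ (i, j) + A $$ (i + 1, j + 1) - A $$ (i + 1, j) - A $$ (i, j + 1) = 0)"

section \<open>A model of computation with unit-cost integer operations\<close>

text \<open>
  Algorithms are programs of a deterministic imperative language whose store consists of
  integer scalars and two-dimensional integer arrays. A program is a finite syntactic object,
  so it cannot depend on the input. Every constant, variable access, arithmetic operation,
  comparison, logical connective and command costs one unit of time.
\<close>

type_synonym vname = string

datatype loc = Scalar vname | Entry vname int int

type_synonym store = "loc \<Rightarrow> int"

datatype arith_op = Add | Sub | Mul | Div | Mod

datatype exp =
    Lit int
  | Var vname
  | Elem vname exp exp
  | Arith arith_op exp exp

datatype test =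
    Equal exp exp
  | Less exp exp
  | Leq exp exp
  | Neg test
  | Conj test test
  | Disj test test

datatype prog =
    Skip
  | Assign vname exp
  | Store vname exp exp exp
  | Seq prog prog
  | Cond test prog prog
  | Loop test prog

text \<open>Division is that of HOL: it rounds towards minus infinity, and \<open>x div 0 = 0\<close>.\<close>

fun arith :: "arith_op \<Rightarrow> int \<Rightarrow> int \<Rightarrow> int" where
  "arith Add x y = x + y"
| "arith Sub x y = x - y"
| "arith Mul x y = x * y"
| "arith Div x y = x div y"
| "arith Mod x y = x mod y"

fun eval_exp :: "exp \<Rightarrow> store \<Rightarrow> int" where
  "eval_exp (Lit k) s = k"
| "eval_exp (Var x) s = s (Scalar x)"
| "eval_exp (Elem x a b) s = s (Entry x (eval_exp a s) (eval_exp b s))"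
| "eval_exp (Arith f a b) s = arith f (eval_exp a s) (eval_exp b s)"

fun eval_test :: "test \<Rightarrow> store \<Rightarrow> bool" where
  "eval_test (Equal a b) s \<longleftrightarrow> eval_exp a s = eval_exp b s"
| "eval_test (Less a b) s \<longleftrightarrow> eval_exp a s < eval_exp b s"
| "eval_test (Leq a b) s \<longleftrightarrow> eval_exp a s \<le> eval_exp b s"
| "eval_test (Neg t) s \<longleftrightarrow> \<not> eval_test t s"
| "eval_test (Conj t u) s \<longleftrightarrow> eval_test t s \<and> eval_test u s"
| "eval_test (Disj t u) s \<longleftrightarrow> eval_test t s \<or> eval_test u s"

fun cost_exp :: "exp \<Rightarrow> nat" where
  "cost_exp (Lit k) = 1"
| "cost_exp (Var x) = 1"
| "cost_exp (Elem x a b) = cost_exp a + cost_exp b + 1"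
| "cost_exp (Arith f a b) = cost_exp a + cost_exp b + 1"

text \<open>Connectives evaluate both arguments, so the cost of a test is independent of the store.\<close>

fun cost_test :: "test \<Rightarrow> nat" where
  "cost_test (Equal a b) = cost_exp a + cost_exp b + 1"
| "cost_test (Less a b) = cost_exp a + cost_exp b + 1"
| "cost_test (Leq a b) = cost_exp a + cost_exp b + 1"
| "cost_test (Neg t) = cost_test t + 1"
| "cost_test (Conj t u) = cost_test t + cost_test u + 1"
| "cost_test (Disj t u) = cost_test t + cost_test u + 1"

text \<open>\<open>run c s k s'\<close>: started in store \<open>s\<close>, the program \<open>c\<close> terminates in store \<open>s'\<close> after
  exactly \<open>k\<close> units of time.\<close>

inductive run :: "prog \<Rightarrow> store \<Rightarrow> nat \<Rightarrow> store \<Rightarrow> bool" where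
  run_Skip: "run Skip s 1 s"
| run_Assign: "run (Assign x a) s (cost_exp a + 1) (s(Scalar x := eval_exp a s))"
| run_Store:
    "run (Store x a b e) s (cost_exp a + cost_exp b + cost_exp e + 1)
       (s(Entry x (eval_exp a s) (eval_exp b s) := eval_exp e s))"
| run_Seq: "run c s k s' \<Longrightarrow> run d s' l s'' \<Longrightarrow> run (Seq c d) s (k + l + 1) s''"
| run_Cond_True:
    "eval_test t s \<Longrightarrow> run c s k s' \<Longrightarrow> run (Cond t c d) s (cost_test t + k + 1) s'"
| run_Cond_False:
    "\<not> eval_test t s \<Longrightarrow> run d s k s' \<Longrightarrow> run (Cond t c d) s (cost_test t + k + 1) s'"
| run_Loop_False: "\<not> eval_test t s \<Longrightarrow> run (Loop t c) s (cost_test t + 1) s"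
| run_Loop_True:
    "eval_test t s \<Longrightarrow> run c s k s' \<Longrightarrow> run (Loop t c) s' l s'' \<Longrightarrow>
       run (Loop t c) s (cost_test t + k + l + 1) s''"

inductive_cases run_SkipE: "run Skip s k s'"
inductive_cases run_AssignE: "run (Assign x a) s k s'"
inductive_cases run_StoreE: "run (Store x a b e) s k s'"
inductive_cases run_SeqE: "run (Seq c d) s k s'"
inductive_cases run_CondE: "run (Cond t c d) s k s'"
inductive_cases run_LoopE: "run (Loop t c) s k s'"

text \<open>The final store and the running time are determined by the program and the initial store,
  so asserting that some run has a property says that the run has it.\<close>

lemma run_deterministic:
  "run c s k s' \<Longrightarrow> run c s l s'' \<Longrightarrow> l = k \<and> s'' = s'"
proof (induction arbitrary: l s'' rule: run.induct)
  case (run_Skip s)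
  then show ?case by (elim run_SkipE) simp
next
  case (run_Assign x a s)
  then show ?case by (elim run_AssignE) simp
next
  case (run_Store x a b e s)
  then show ?case by (elim run_StoreE) simp
next
  case (run_Seq c s k s' d k' s3)
  from run_Seq.prems obtain k1 u k2
    where *: "l = Suc (k1 + k2)" "run c s k1 u" "run d u k2 s''"
    by (rule run_SeqE)
  have u: "k1 = k" "u = s'" using run_Seq.IH(1)[OF *(2)] by blast+
  have "k2 = k' \<and> s'' = s3" using run_Seq.IH(2)[OF *(3)[unfolded u]] .
  with *(1) u show ?case by simp
next
  case (run_Cond_True t s c k s' d)
  then obtain k1 where *: "l = Suc (cost_test t + k1)" "run c s k1 s''"
    by (blast elim: run_CondE)
  from run_Cond_True.IH[OF *(2)] *(1) show ?case by simp
next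
  case (run_Cond_False t s d k s' c)
  then obtain k1 where *: "l = Suc (cost_test t + k1)" "run d s k1 s''"
    by (blast elim: run_CondE)
  from run_Cond_False.IH[OF *(2)] *(1) show ?case by simp
next
  case (run_Loop_False t s c)
  then have "l = Suc (cost_test t)" "s'' = s"
    by (blast elim: run_LoopE)+
  then show ?case by simp
next
  case (run_Loop_True t s c k s' k' s3)
  then obtain k1 u k2
    where *: "l = Suc (cost_test t + k1 + k2)" "run c s k1 u" "run (Loop t c) u k2 s''"
    by (blast elim: run_LoopE)
  have u: "k1 = k" "u = s'" using run_Loop_True.IH(1)[OF *(2)] by blast+
  have "k2 = k' \<and> s'' = s3" using run_Loop_True.IH(2)[OF *(3)[unfolded u]] .
  with *(1) u show ?case by simp
qed

section \<open>Input and output of a reconstruction algorithm\<close>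

text \<open>Everything but the input is initially 0.\<close>

fun input_store :: "nat \<Rightarrow> nat \<Rightarrow> int mat \<Rightarrow> store" where
  "input_store p q A (Scalar x) =
     (if x = ''p'' then int p
      else if x = ''q'' then int q
      else if x = ''rows'' then int (dim_row A)
      else if x = ''cols'' then int (dim_col A)
      else 0)"
| "input_store p q A (Entry x i j) =
     (if x = ''A'' \<and> 0 \<le> i \<and> i < int (dim_row A) \<and> 0 \<le> j \<and> j < int (dim_col A)
      then A $$ (nat i, nat j) else 0)"

datatype outcome = FAILURE | Output "int mat"

definition outcome_of :: "nat \<Rightarrow> nat \<Rightarrow> store \<Rightarrow> outcome" where
  "outcome_of m n s =
     (if s (Scalar ''failure'') \<noteq> 0 then FAILURE
      else Output (mat m n (\<lambda>(i, j). s (Entry ''M'' (int i) (int j)))))"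

definition is_reconstruction :: "nat \<Rightarrow> nat \<Rightarrow> int mat \<Rightarrow> nat \<Rightarrow> nat \<Rightarrow> int mat \<Rightarrow> bool" where
  "is_reconstruction p q A m n M \<longleftrightarrow>
     M \<in> carrier_mat m n \<and> binary_mat M \<and> rect_scan p q M = A"

definition correct_outcome :: "nat \<Rightarrow> nat \<Rightarrow> int mat \<Rightarrow> nat \<Rightarrow> nat \<Rightarrow> outcome \<Rightarrow> bool" where
  "correct_outcome p q A m n r \<longleftrightarrow>
     (if \<exists>M. is_reconstruction p q A m n M
      then \<exists>M. r = Output M \<and> is_reconstruction p q A m n M
      else r = FAILURE)"

end

theory Submission
  imports Defs
begin

text \<open>
  Why a polynomial algorithm exists. Let \<open>M\<close> be a binary matrix whose scan \<open>A\<close> is smooth. The second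
  difference of \<open>A\<close> at \<open>(i, j)\<close> is \<open>M[i,j] + M[i+p,j+q] - M[i+p,j] - M[i,j+q]\<close>, so this vanishes
  everywhere. On each of the \<open>p * q\<close> classes of positions \<open>(i mod p, j mod q)\<close>, the matrix is therefore
  a sum of a function of the row and a function of the column, and since its entries are \<open>0\<close> and \<open>1\<close>,
  one of the two summands is constant (\<open>class_dichotomy\<close>): a class depends on the row only or on the
  column only. Each row of a window meets every class of its own residue exactly once, and likewise
  each column, so the sum of a window is a sum of contributions \<open>S i\<close> of its rows, which come from
  the classes of the first kind, and contributions \<open>U j\<close> of its columns, which come from the others (\<open>window_split\<close>). Sliding the window
  by one row shows \<open>S (i + p) - S i = A[i+1,0] - A[i,0]\<close>. Hence \<open>S i\<close> is its initial value \<open>S (i mod p)\<close>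
  plus a number \<open>P i\<close>, the drift, that can be computed from \<open>A\<close>; likewise \<open>U j = U (j mod q) + Q j\<close>.

  The scan depends on \<open>M\<close> through \<open>S\<close> and \<open>U\<close> only, so the ones of a row may be redistributed among its
  classes of the first kind, by switching these classes on in a fixed order until \<open>S i\<close> ones are
  placed. In the resulting solution, the entry at \<open>(i, j)\<close> is a function of
  \<open>(i mod p, j mod q, P i, Q j)\<close> alone (\<open>solution_normal_form\<close>). As \<open>\<bar>P i\<bar> \<le> q\<close> and \<open>\<bar>Q j\<bar> \<le> p\<close>, this
  function has a domain of \<open>p * q * (2 * q + 1) * (2 * p + 1)\<close> elements, whatever the size of \<open>A\<close>.

  The algorithm computes the drifts and tries all these functions, each coded as the
  binary digits of a number \<open>g\<close>. For each it writes down the matrix and compares the scan with \<open>A\<close>,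
  which takes time proportional to \<open>m * n\<close> with the help of sums over initial rectangles. An output
  is correct because it was compared; a failure is correct because of the normal form
  (\<open>ex_good\<close>). The number of trials depends on \<open>p\<close> and \<open>q\<close> only, so for fixed \<open>p\<close> and \<open>q\<close> the running
  time is at most a constant times \<open>m * n\<close>.
\<close>

section \<open>Window sums and sums over initial rectangles\<close>

definition window :: "nat \<Rightarrow> nat \<Rightarrow> (nat \<Rightarrow> nat \<Rightarrow> int) \<Rightarrow> nat \<Rightarrow> nat \<Rightarrow> int" where
  "window p q f i j = (\<Sum>r<p. \<Sum>c<q. f (i + r) (j + c))"

definition area :: "(nat \<Rightarrow> nat \<Rightarrow> int) \<Rightarrow> nat \<Rightarrow> nat \<Rightarrow> int" where
  "area f i j = (\<Sum>r<i. \<Sum>c<j. f r c)"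

lemma area_0 [simp]: "area f 0 j = 0" "area f i 0 = 0"
  by (simp_all add: area_def)

lemma mod_less_of_le: "0 < p \<Longrightarrow> p \<le> m \<Longrightarrow> i mod p < (m::nat)"
  by (rule less_le_trans[OF mod_less_divisor])

lemma sum_lessThan_add:
  fixes i p :: nat
  shows "(\<Sum>r<i + p. h r) = (\<Sum>r<i. h r) + (\<Sum>r<p. h (i + r) :: int)"
  by (induction p) (simp_all add: add.assoc)

lemma window_eq_area:
  "window p q f i j = area f (i + p) (j + q) - area f i (j + q) - area f (i + p) j + area f i j"
  by (simp add: window_def area_def sum_lessThan_add sum.distrib)

lemma area_Suc_Suc:
  "area f (Suc i) (Suc j) = area f i (Suc j) + area f (Suc i) j - area f i j + f i j"
  by (simp add: area_def sum.distrib)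

lemma smooth_if_window_smooth:
  assumes "window p q f i j + window p q f (Suc i) (Suc j)
           = window p q f (Suc i) j + window p q f i (Suc j)"
  shows "f i j + f (i + p) (j + q) = f (i + p) j + f i (j + q)"
  using assms area_Suc_Suc[of f i j] area_Suc_Suc[of f "i + p" "j + q"]
    area_Suc_Suc[of f "i + p" j] area_Suc_Suc[of f i "j + q"]
  by (simp add: window_eq_area)

section \<open>Residue classes of a smooth binary matrix\<close>

text \<open>The smoothness relation steps by \<open>q\<close> along rows and by \<open>p\<close> along columns; following it back to
  the first block makes the mixed difference vanish on every rectangle of a residue class.\<close>

lemma class_additive:
  fixes f :: "nat \<Rightarrow> nat \<Rightarrow> int"
  assumes "0 < p" "0 < q"
    and smooth: "\<And>i j. i + p < m \<Longrightarrow> j + q < n \<Longrightarrow>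
      f i j + f (i + p) (j + q) = f (i + p) j + f i (j + q)"
    and "i < m" "j < n"
  shows "f i j + f (i mod p) (j mod q) = f i (j mod q) + f (i mod p) j"
proof -
  have step: "f (i + p) j - f i j = f (i + p) (j mod q) - f i (j mod q)"
    if "i + p < m" "j < n" for i j
    using that
  proof (induction j rule: less_induct)
    case (less j)
    show ?case
    proof (cases "j < q")
      case False
      with less.IH[of "j - q"] less.prems smooth[of i "j - q"] \<open>0 < q\<close>
      show ?thesis by (simp add: le_mod_geq less_imp_diff_less)
    qed simp
  qed
  show ?thesis using \<open>i < m\<close>
  proof (induction i rule: less_induct)
    case (less i)
    show ?case
    proof (cases "i < p")
      case False
      with less.IH[of "i - p"] less.prems step[of "i - p" j] \<open>0 < p\<close> \<open>j < n\<close>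
      show ?thesis by (simp add: le_mod_geq less_imp_diff_less)
    qed simp
  qed
qed

text \<open>If both the row and the column summand varied in a class, with base value \<open>x = f a b\<close>, then the two
  variations would both lead from \<open>x\<close> to \<open>1 - x\<close>, and the entry where they meet would be \<open>2 - 3 * x\<close>, which is
  neither \<open>0\<close> nor \<open>1\<close>. The predicate \<open>T\<close> marks the classes that depend on the row only.\<close>

lemma class_dichotomy:
  fixes f :: "nat \<Rightarrow> nat \<Rightarrow> int"
  assumes "0 < p" "0 < q" "p \<le> m" "q \<le> n"
    and smooth: "\<And>i j. i + p < m \<Longrightarrow> j + q < n \<Longrightarrow>
      f i j + f (i + p) (j + q) = f (i + p) j + f i (j + q)"
    and binary: "\<And>i j. i < m \<Longrightarrow> j < n \<Longrightarrow> f i j \<in> {0, 1}"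
  obtains T where "\<And>i j. i < m \<Longrightarrow> j < n \<Longrightarrow>
    f i j = (if T (i mod p) (j mod q) then f i (j mod q) else f (i mod p) j)"
proof
  define T where "T a b \<longleftrightarrow> (\<forall>j<n. j mod q = b \<longrightarrow> f a j = f a b)" for a b
  fix i j assume ij: "i < m" "j < n"
  define a b where "a = i mod p" and "b = j mod q"
  have ab: "a < m" "b < n" "a mod p = a" "b mod q = b"
    using assms(1-4) by (simp_all add: a_def b_def mod_less_of_le)
  have add: "f i' j' + f a b = f i' b + f a j'"
    if "i' < m" "i' mod p = a" "j' < n" "j' mod q = b" for i' j'
    using class_additive[where f = f and m = m and n = n, OF assms(1,2) smooth, of i' j'] that by simp
  have "f i j = (if T a b then f i b else f a j)"
  proof (cases "T a b")
    case True
    then have "f a j = f a b" using ij by (auto simp: T_def b_def)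
    with True add[of i j] ij show ?thesis by (simp add: a_def b_def)
  next
    case False
    \<comment> \<open>The entry meeting row \<open>i\<close> and column \<open>j0\<close> forces \<open>f i b = f a b\<close>, since \<open>f a j0\<close> already varies.\<close>
    then obtain j0 where j0: "j0 < n" "j0 mod q = b" "f a j0 \<noteq> f a b"
      by (auto simp: T_def)
    have "f i j0 + f a b = f i b + f a j0" using add[of i j0] ij j0 by (simp add: a_def)
    then have "f i b = f a b"
      using j0 binary[of i j0] binary[of a b] binary[of i b] binary[of a j0] ij ab by auto
    with False add[of i j] ij show ?thesis by (simp add: a_def b_def)
  qed
  then show "f i j = (if T (i mod p) (j mod q) then f i (j mod q) else f (i mod p) j)"
    by (simp add: a_def b_def)
qed

text \<open>Any \<open>q\<close> consecutive numbers represent every residue modulo \<open>q\<close> once.\<close>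

lemma sum_cyclic_shift:
  fixes h :: "nat \<Rightarrow> int"
  assumes "0 < q"
  shows "(\<Sum>c<q. h ((j + c) mod q)) = (\<Sum>b<q. h b)"
proof (induction j)
  case (Suc j)
  have "(\<Sum>c<q. h ((Suc j + c) mod q)) + h (j mod q) = (\<Sum>c<Suc q. h ((j + c) mod q))"
    unfolding sum.lessThan_Suc_shift by simp
  also have "\<dots> = (\<Sum>c<q. h ((j + c) mod q)) + h (j mod q)" by simp
  finally show ?case using Suc by simp
qed simp

definition row_part :: "(nat \<Rightarrow> nat \<Rightarrow> bool) \<Rightarrow> nat \<Rightarrow> nat \<Rightarrow> (nat \<Rightarrow> nat \<Rightarrow> int) \<Rightarrow> nat \<Rightarrow> int" where
  "row_part T p q f i = (\<Sum>b<q. if T (i mod p) b then f i b else 0)"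

definition col_part :: "(nat \<Rightarrow> nat \<Rightarrow> bool) \<Rightarrow> nat \<Rightarrow> nat \<Rightarrow> (nat \<Rightarrow> nat \<Rightarrow> int) \<Rightarrow> nat \<Rightarrow> int" where
  "col_part T p q f j = (\<Sum>a<p. if T a (j mod q) then 0 else f a j)"

text \<open>Replacing the column index by its residue in the classes that depend on the row, and the row
  index in the others, turns each window into a complete system of residues. So the window sum
  knows the matrix through \<open>row_part\<close> and \<open>col_part\<close> only, which is what allows the entries to be
  rearranged later.\<close>

lemma window_split:
  assumes "0 < p" "0 < q"
    and split: "\<And>i j. i < m \<Longrightarrow> j < n \<Longrightarrow>
      f i j = (if T (i mod p) (j mod q) then f i (j mod q) else f (i mod p) j)"
    and "i + p \<le> m" "j + q \<le> n"
  shows "window p q f i j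
    = (\<Sum>r<p. row_part T p q f (i + r)) + (\<Sum>c<q. col_part T p q f (j + c))"
proof -
  define R where "R x b = (if T (x mod p) b then f x b else 0)" for x b
  define K where "K a y = (if T a (y mod q) then 0 else f a y)" for a y
  have "window p q f i j
    = (\<Sum>r<p. \<Sum>c<q. R (i + r) ((j + c) mod q) + K ((i + r) mod p) (j + c))"
    unfolding window_def
  proof (intro sum.cong refl)
    fix r c assume "r \<in> {..<p}" "c \<in> {..<q}"
    then show "f (i + r) (j + c) = R (i + r) ((j + c) mod q) + K ((i + r) mod p) (j + c)"
      using split[of "i + r" "j + c"] assms(4,5) by (simp add: R_def K_def)
  qed
  also have "\<dots> = (\<Sum>r<p. \<Sum>c<q. R (i + r) ((j + c) mod q))
      + (\<Sum>c<q. \<Sum>r<p. K ((i + r) mod p) (j + c))"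
    using sum.swap[of "\<lambda>r c. K ((i + r) mod p) (j + c)" "{..<q}" "{..<p}"]
    by (simp add: sum.distrib)
  also have "\<dots> = (\<Sum>r<p. \<Sum>b<q. R (i + r) b) + (\<Sum>c<q. \<Sum>a<p. K a (j + c))"
    using sum_cyclic_shift[OF assms(2), of "R _" j]
      sum_cyclic_shift[OF assms(1), of "\<lambda>a. K a _" i] by simp
  finally show ?thesis by (simp add: R_def K_def row_part_def col_part_def)
qed

section \<open>Drifts\<close>

text \<open>The forward differences of \<open>v\<close>, accumulated along the residue class of \<open>i\<close> modulo \<open>p\<close>, from its
  least member up to \<open>i\<close>.\<close>

definition drift :: "nat \<Rightarrow> (nat \<Rightarrow> int) \<Rightarrow> nat \<Rightarrow> int" where
  "drift p v i = (\<Sum>l<i div p. v (Suc (i mod p + l * p)) - v (i mod p + l * p))"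

lemma drift_less [simp]: "i < p \<Longrightarrow> drift p v i = 0"
  by (simp add: drift_def)

lemma drift_add: "0 < p \<Longrightarrow> drift p v (i + p) = drift p v i + (v (Suc i) - v i)"
  by (simp add: drift_def)

text \<open>Two consecutive window sums differ in the entering term \<open>S (i + p)\<close> and the leaving term \<open>S i\<close>. The
  constant \<open>e\<close> absorbs the contribution of the other direction of a rectangular window.\<close>

lemma eq_drift_if_sliding_sums:
  fixes S :: "nat \<Rightarrow> int"
  assumes "0 < p"
    and v: "\<And>i. i < k \<Longrightarrow> v i = (\<Sum>r<p. S (i + r)) + e"
    and "i < k + p - 1"
  shows "S i = S (i mod p) + drift p v i"
  using \<open>i < k + p - 1\<close>
proof (induction i rule: less_induct)
  case (less i)
  show ?case
  proof (cases "i < p")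
    case False
    define x where "x = i - p"
    have i: "i = x + p" using False by (simp add: x_def)
    have x: "Suc x < k" using less.prems i by simp
    have "(\<Sum>r<p. S (Suc x + r)) + S x = (\<Sum>r<Suc p. S (x + r))"
      unfolding sum.lessThan_Suc_shift by simp
    then have "v (Suc x) - v x = S (x + p) - S x" using v[of x] v[of "Suc x"] x by simp
    moreover have "S x = S (x mod p) + drift p v x" using less.IH[of x] less.prems i \<open>0 < p\<close> by simp
    ultimately show ?thesis using \<open>0 < p\<close> by (simp add: i drift_add)
  qed simp
qed

section \<open>Solutions determined by residues and drifts\<close>

text \<open>The indices in \<open>B x\<close> are ranked by \<open>\<rho> x\<close>, so that exactly \<open>s\<close> of them have rank below \<open>s\<close>. The point
  is that one ranking serves all totals \<open>s\<close>: it does not have to change from row to row.\<close>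

lemma ex_threshold_filling:
  "\<exists>\<rho> :: nat \<Rightarrow> nat \<Rightarrow> int. \<forall>x s. 0 \<le> s \<longrightarrow> s \<le> int (card {b. b < q \<and> B x b}) \<longrightarrow>
       (\<Sum>b<q. if B x b then if \<rho> x b < s then 1 else 0 else 0) = s"
proof -
  let ?X = "\<lambda>x. {b. b < q \<and> B x b}"
  have "\<forall>x. \<exists>h. bij_betw h (?X x) {0..<card (?X x)}"
    using ex_bij_betw_finite_nat[of "?X _"] by simp
  from choice[OF this] obtain h where h: "\<And>x. bij_betw (h x) (?X x) {0..<card (?X x)}"
    by blast
  show ?thesis
  proof (intro exI allI impI)
    fix x and s :: int assume s: "0 \<le> s" "s \<le> int (card (?X x))"
    let ?Y = "{b \<in> ?X x. h x b < nat s}"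
    have "h x ` ?Y = {0..<nat s}"
    proof
      show "{0..<nat s} \<subseteq> h x ` ?Y"
      proof
        fix t assume t: "t \<in> {0..<nat s}"
        then have "t \<in> h x ` ?X x" using h[of x] s by (auto simp: bij_betw_def)
        with t show "t \<in> h x ` ?Y" by auto
      qed
    qed auto
    moreover have "inj_on (h x) ?Y"
      using h[of x] by (auto simp: bij_betw_def inj_on_def)
    ultimately have "card ?Y = card {0..<nat s}"
      using card_image[of "h x" ?Y] by simp
    moreover have "(\<Sum>b<q. if B x b then if int (h x b) < s then 1 else 0 else 0) = int (card ?Y)"
    proof -
      have "(\<Sum>b<q. if B x b then if int (h x b) < s then 1 else 0 else 0)
          = (\<Sum>b\<in>{..<q}. of_bool (b \<in> ?Y) :: int)"
        by (intro sum.cong) auto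
      also have "\<dots> = int (card ?Y)"
        by (subst sum_of_bool_eq) (auto intro!: arg_cong[of _ _ card])
      finally show ?thesis .
    qed
    ultimately show "(\<Sum>b<q. if B x b then if int (h x b) < s then 1 else 0 else 0) = s"
      using s by simp
  qed
qed

lemma masked_sum_bounds:
  fixes f :: "nat \<Rightarrow> int"
  assumes "\<And>b. b < q \<Longrightarrow> f b \<in> {0, 1}"
  shows "0 \<le> (\<Sum>b<q. if B b then f b else 0)"
    and "(\<Sum>b<q. if B b then f b else 0) \<le> int (card {b. b < q \<and> B b})"
    and "(\<Sum>b<q. if B b then f b else 0) \<le> int q"
proof -
  have f: "0 \<le> f b" "f b \<le> 1" if "b < q" for b
    using assms[OF that] by auto
  show "0 \<le> (\<Sum>b<q. if B b then f b else 0)"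
    by (intro sum_nonneg) (simp add: f)
  have "(\<Sum>b<q. if B b then f b else 0) \<le> (\<Sum>b<q. of_bool (B b))"
    by (intro sum_mono) (simp add: f)
  also have "\<dots> = int (card {b. b < q \<and> B b})"
    by (simp add: sum_of_bool_eq) (metis Collect_conj_eq lessThan_def)
  finally show "(\<Sum>b<q. if B b then f b else 0) \<le> int (card {b. b < q \<and> B b})" .
  have "(\<Sum>b<q. if B b then f b else 0) \<le> (\<Sum>b<q. 1)"
    by (intro sum_mono) (simp add: f)
  then show "(\<Sum>b<q. if B b then f b else 0) \<le> int q" by simp
qed

text \<open>A drift is the difference of two contributions of rows, both in \<open>{0..q}\<close>, or of columns, both in
  \<open>{0..p}\<close>; this bounds it. The threshold filling with the same row and column contributions as \<open>f\<close> has the same scan.\<close>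

theorem solution_normal_form:
  fixes f a :: "nat \<Rightarrow> nat \<Rightarrow> int"
  assumes "0 < p" "0 < q" "0 < m'" "0 < n'"
    and m: "m = m' + p - 1" and n: "n = n' + q - 1"
    and smooth: "\<And>i j. Suc i < m' \<Longrightarrow> Suc j < n' \<Longrightarrow>
      a i j + a (Suc i) (Suc j) = a (Suc i) j + a i (Suc j)"
    and binary: "\<And>i j. i < m \<Longrightarrow> j < n \<Longrightarrow> f i j \<in> {0, 1}"
    and scan: "\<And>i j. i < m' \<Longrightarrow> j < n' \<Longrightarrow> window p q f i j = a i j"
  defines "P \<equiv> drift p (\<lambda>i. a i 0)" and "Q \<equiv> drift q (a 0)"
  obtains h where "\<And>x y u v. h x y u v \<in> {0, 1 :: int}"
    and "\<And>i j. i < m' \<Longrightarrow> j < n' \<Longrightarrow>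
      window p q (\<lambda>i j. h (i mod p) (j mod q) (P i) (Q j)) i j = a i j"
    and "\<And>i. i < m \<Longrightarrow> \<bar>P i\<bar> \<le> int q"
    and "\<And>j. j < n \<Longrightarrow> \<bar>Q j\<bar> \<le> int p"
proof -
  have le: "p \<le> m" "q \<le> n" using assms(3,4) m n by simp_all
  have smooth_f: "f i j + f (i + p) (j + q) = f (i + p) j + f i (j + q)"
    if "i + p < m" "j + q < n" for i j
    using that m n by (intro smooth_if_window_smooth) (simp add: scan smooth)
  obtain T where T: "\<And>i j. i < m \<Longrightarrow> j < n \<Longrightarrow>
      f i j = (if T (i mod p) (j mod q) then f i (j mod q) else f (i mod p) j)"
    by (rule class_dichotomy[of p q m n f]) (use assms(1,2) le smooth_f binary in blast)+
  define S where "S = row_part T p q f"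
  define U where "U = col_part T p q f"
  have split: "a i j = (\<Sum>r<p. S (i + r)) + (\<Sum>c<q. U (j + c))" if "i < m'" "j < n'" for i j
    using window_split[where f = f and T = T and m = m and n = n, OF assms(1,2) T, of i j] that m n scan[of i j] by (simp add: S_def U_def)
  have S_drift: "S i = S (i mod p) + P i" if "i < m" for i
    unfolding P_def using that split assms(4) m
    by (intro eq_drift_if_sliding_sums[OF assms(1), of m']) auto
  have U_drift: "U j = U (j mod q) + Q j" if "j < n" for j
    unfolding Q_def using that split assms(3) n
    by (intro eq_drift_if_sliding_sums[OF assms(2), of n' _ _ "\<Sum>r<p. S (0 + r)"])
       (auto simp: add.commute)
  have S_bounds: "0 \<le> S i" "S i \<le> int (card {b. b < q \<and> T (i mod p) b})" "S i \<le> int q" if "i < m" for i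
  proof -
    have bin: "\<And>b. b < q \<Longrightarrow> f i b \<in> {0, 1}" using that binary[of i] le by simp
    from masked_sum_bounds[where f = "f i" and q = q and B = "T (i mod p)", OF bin]
    show "0 \<le> S i" "S i \<le> int (card {b. b < q \<and> T (i mod p) b})" "S i \<le> int q"
      by (simp_all add: S_def row_part_def)
  qed
  have U_eq: "U j = (\<Sum>a<p. if \<not> T a (j mod q) then f a j else 0)" for j
    unfolding U_def col_part_def by (intro sum.cong) auto
  have U_bounds: "0 \<le> U j" "U j \<le> int (card {a. a < p \<and> \<not> T a (j mod q)})" "U j \<le> int p" if "j < n" for j
  proof -
    have bin: "\<And>a. a < p \<Longrightarrow> f a j \<in> {0, 1}" using that binary[of _ j] le by simp
    from masked_sum_bounds[where f = "\<lambda>a. f a j" and q = p and B = "\<lambda>a. \<not> T a (j mod q)", OF bin]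
    show "0 \<le> U j" "U j \<le> int (card {a. a < p \<and> \<not> T a (j mod q)})" "U j \<le> int p"
      by (simp_all add: U_eq)
  qed
  obtain \<rho> where \<rho>: "\<And>x s. 0 \<le> s \<Longrightarrow> s \<le> int (card {b. b < q \<and> T x b}) \<Longrightarrow>
       (\<Sum>b<q. if T x b then if \<rho> x b < s then 1 else 0 else 0) = s"
    using ex_threshold_filling[of q T] by blast
  obtain \<sigma> where \<sigma>: "\<And>y s. 0 \<le> s \<Longrightarrow> s \<le> int (card {x. x < p \<and> \<not> T x y}) \<Longrightarrow>
       (\<Sum>x<p. if \<not> T x y then if \<sigma> y x < s then 1 else 0 else 0) = s"
    using ex_threshold_filling[of p "\<lambda>y x. \<not> T x y"] by blast
  define h :: "nat \<Rightarrow> nat \<Rightarrow> int \<Rightarrow> int \<Rightarrow> int" where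
    "h x y u v = (if T x y then if \<rho> x y < S x + u then 1 else 0
                  else if \<sigma> y x < U y + v then 1 else 0)" for x y u v
  define f' where "f' = (\<lambda>i j. h (i mod p) (j mod q) (P i) (Q j))"
  have f': "f' i j = (if T (i mod p) (j mod q) then if \<rho> (i mod p) (j mod q) < S i then 1 else 0
                  else if \<sigma> (j mod q) (i mod p) < U j then 1 else 0)" if "i < m" "j < n" for i j
    using S_drift[of i] U_drift[of j] that by (simp add: f'_def h_def)
  have T': "f' i j = (if T (i mod p) (j mod q) then f' i (j mod q) else f' (i mod p) j)"
    if "i < m" "j < n" for i j
  proof -
    have "i mod p < m" "j mod q < n" using assms(1,2) le by (simp_all add: mod_less_of_le)
    then show ?thesis using that by (simp add: f')
  qed
  have "row_part T p q f' i = S i" if "i < m" for i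
  proof -
    have "row_part T p q f' i
      = (\<Sum>b<q. if T (i mod p) b then if \<rho> (i mod p) b < S i then 1 else 0 else 0)"
      unfolding row_part_def using that le by (intro sum.cong) (simp_all add: f')
    then show ?thesis using \<rho> S_bounds[OF that] by simp
  qed
  moreover have "col_part T p q f' j = U j" if "j < n" for j
  proof -
    have "col_part T p q f' j
      = (\<Sum>a<p. if \<not> T a (j mod q) then if \<sigma> (j mod q) a < U j then 1 else 0 else 0)"
      unfolding col_part_def using that le by (intro sum.cong) (simp_all add: f')
    then show ?thesis using \<sigma> U_bounds[OF that] by simp
  qed
  ultimately have "window p q f' i j = a i j" if "i < m'" "j < n'" for i j
    using window_split[where f = f' and T = T and m = m and n = n, OF assms(1,2) T', of i j] split[of i j] that m n by simp
  moreover have "\<bar>P i\<bar> \<le> int q" if "i < m" for i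
  proof -
    have "i mod p < m" using assms(1) le by (simp_all add: mod_less_of_le)
    then show ?thesis using S_drift[OF that] S_bounds(1,3)[OF that] S_bounds(1,3)[of "i mod p"] by simp
  qed
  moreover have "\<bar>Q j\<bar> \<le> int p" if "j < n" for j
  proof -
    have "j mod q < n" using assms(2) le by (simp_all add: mod_less_of_le)
    then show ?thesis using U_drift[OF that] U_bounds(1,3)[OF that] U_bounds(1,3)[of "j mod q"] by simp
  qed
  ultimately show thesis using that[of h] by (simp add: f'_def h_def)
qed

section \<open>Coding a finite function by a number\<close>

lemma mixed_radix_bound:
  fixes a b :: nat
  assumes "a < r" "b < s"
  shows "a * s + b < r * s"
proof -
  have "Suc a * s \<le> r * s" using assms(1) by (intro mult_le_mono1) simp
  then show ?thesis using assms(2) by simp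
qed

lemma ex_nat_with_bits:
  fixes F :: "nat \<Rightarrow> int"
  assumes "\<And>k. F k \<in> {0, 1}"
  obtains g :: nat where "g < 2 ^ L" "\<And>k. k < L \<Longrightarrow> int g div 2 ^ k mod 2 = F k"
proof -
  have "\<exists>g::nat. g < 2 ^ L \<and> (\<forall>k<L. int g div 2 ^ k mod 2 = F k)"
    using assms
  proof (induction L arbitrary: F)
    case (Suc L)
    from Suc.IH[of "\<lambda>k. F (Suc k)"] Suc.prems obtain g :: nat where
      g: "g < 2 ^ L" "\<forall>k<L. int g div 2 ^ k mod 2 = F (Suc k)" by auto
    define g' where "g' = 2 * g + nat (F 0)"
    have F0: "F 0 = 0 \<or> F 0 = 1" using Suc.prems by auto
    have "int g' div 2 ^ k mod 2 = F k" if "k < Suc L" for k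
    proof (cases k)
      case 0
      then show ?thesis using F0 by (auto simp: g'_def)
    next
      case (Suc k')
      have "int g' div 2 = int g" using F0 by (auto simp: g'_def)
      then have "int g' div 2 ^ k = int g div 2 ^ k'"
        by (simp add: Suc zdiv_zmult2_eq)
      then show ?thesis using g(2) that Suc by simp
    qed
    moreover have "g' < 2 ^ Suc L" using g(1) F0 by (auto simp: g'_def)
    ultimately show ?case by blast
  qed simp
  then show thesis using that by blast
qed

section \<open>Reasoning about timed runs\<close>

text \<open>Total correctness with a time bound.\<close>

definition ends :: "prog \<Rightarrow> store \<Rightarrow> nat \<Rightarrow> (store \<Rightarrow> bool) \<Rightarrow> bool" where
  "ends c s K Q \<longleftrightarrow> (\<exists>k s'. run c s k s' \<and> k \<le> K \<and> Q s')"

lemma ends_mono: "ends c s K R \<Longrightarrow> K \<le> L \<Longrightarrow> (\<And>s'. R s' \<Longrightarrow> Q s') \<Longrightarrow> ends c s L Q"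
  unfolding ends_def by (meson order_trans)

lemma ends_Seq:
  assumes "ends c s K R" and "\<And>s'. R s' \<Longrightarrow> ends d s' L Q"
  shows "ends (Seq c d) s (K + L + 1) Q"
proof -
  from assms(1) obtain k s' where c: "run c s k s'" "k \<le> K" "R s'" by (auto simp: ends_def)
  from assms(2)[OF c(3)] obtain l s'' where d: "run d s' l s''" "l \<le> L" "Q s''"
    by (auto simp: ends_def)
  have "run (Seq c d) s (k + l + 1) s''" using c d by (blast intro: run_Seq)
  then show ?thesis using c d unfolding ends_def by (intro exI conjI) auto
qed

lemma ends_Assign: "Q (s(Scalar x := eval_exp a s)) \<Longrightarrow> ends (Assign x a) s (cost_exp a + 1) Q"
  unfolding ends_def using run_Assign by blast

text \<open>The invariant \<open>I\<close> counts the iterations done so far; since \<open>N\<close> bounds them even when the loop stops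
  earlier, the rule covers both counting loops and the search with its early exit.\<close>

lemma ends_Loop:
  assumes "I 0 s"
    and step: "\<And>t s. I t s \<Longrightarrow> eval_test b s \<Longrightarrow> t < N \<and> ends c s K (I (Suc t))"
  shows "ends (Loop b c) s (N * (cost_test b + K + 1) + cost_test b + 1)
    (\<lambda>s'. \<exists>t\<le>N. I t s' \<and> \<not> eval_test b s')"
proof -
  define X where "X = cost_test b + K + 1"
  have "ends (Loop b c) s ((N - t) * X + cost_test b + 1)
      (\<lambda>s'. \<exists>t\<le>N. I t s' \<and> \<not> eval_test b s')"
    if "I t s" "t \<le> N" for t s
    using that
  proof (induction "N - t" arbitrary: t s rule: less_induct)
    case less
    show ?case
    proof (cases "eval_test b s")
      case False
      with less.prems show ?thesis
        unfolding ends_def using run_Loop_False[OF False, of c]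
        by (intro exI[of _ "cost_test b + 1"] exI[of _ s]) auto
    next
      case True
      from step[OF less.prems(1) True] obtain k s' where
        body: "t < N" "run c s k s'" "k \<le> K" "I (Suc t) s'" by (auto simp: ends_def)
      from less.hyps[of "Suc t" s'] body obtain l s'' where
        rest: "run (Loop b c) s' l s''"
          "l \<le> (N - Suc t) * X + cost_test b + 1"
          "\<exists>t\<le>N. I t s'' \<and> \<not> eval_test b s''"
        unfolding ends_def by (meson Suc_leI diff_less_mono2 lessI)
      have "N - t = Suc (N - Suc t)" using body(1) by simp
      then have "cost_test b + k + l + 1 \<le> (N - t) * X + cost_test b + 1"
        using body(3) rest(2) by (simp add: X_def)
      with run_Loop_True[OF True body(2) rest(1)] rest(3) show ?thesis
        unfolding ends_def by blast
    qed
  qed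
  from this[OF assms(1)] show ?thesis by (simp add: X_def)
qed

text \<open>Without loops, a program denotes a function on stores, and its cost has a bound that depends on
  its text only. Invariants of loop bodies can then be verified by rewriting.\<close>

fun loop_free :: "prog \<Rightarrow> bool" where
  "loop_free (Seq c d) \<longleftrightarrow> loop_free c \<and> loop_free d"
| "loop_free (Cond t c d) \<longleftrightarrow> loop_free c \<and> loop_free d"
| "loop_free (Loop t c) \<longleftrightarrow> False"
| "loop_free _ \<longleftrightarrow> True"

fun exec :: "prog \<Rightarrow> store \<Rightarrow> store" where
  "exec Skip s = s"
| "exec (Assign x a) s = s(Scalar x := eval_exp a s)"
| "exec (Store x a b e) s = s(Entry x (eval_exp a s) (eval_exp b s) := eval_exp e s)"
| "exec (Seq c d) s = exec d (exec c s)"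
| "exec (Cond t c d) s = (if eval_test t s then exec c s else exec d s)"
| "exec (Loop t c) s = s"

fun max_cost :: "prog \<Rightarrow> nat" where
  "max_cost Skip = 1"
| "max_cost (Assign x a) = cost_exp a + 1"
| "max_cost (Store x a b e) = cost_exp a + cost_exp b + cost_exp e + 1"
| "max_cost (Seq c d) = max_cost c + max_cost d + 1"
| "max_cost (Cond t c d) = cost_test t + max (max_cost c) (max_cost d) + 1"
| "max_cost (Loop t c) = 0"

lemma run_loop_free: "loop_free c \<Longrightarrow> \<exists>k \<le> max_cost c. run c s k (exec c s)"
proof (induction c arbitrary: s)
  case Skip
  then show ?case using run_Skip by auto
next
  case (Assign x a)
  then show ?case using run_Assign[of x a s] by (auto simp: fun_upd_def)
next
  case (Store x a b e)
  then show ?case using run_Store[of x a b e s] by (auto simp: fun_upd_def)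
next
  case (Seq c d)
  then obtain k l where "run c s k (exec c s)" "k \<le> max_cost c"
    "run d (exec c s) l (exec d (exec c s))" "l \<le> max_cost d" by fastforce
  with run_Seq[of c s k "exec c s" d l] show ?case by (intro exI[of _ "k + l + 1"]) auto
next
  case (Cond t c d)
  show ?case
  proof (cases "eval_test t s")
    case True
    from Cond obtain k where "k \<le> max_cost c" "run c s k (exec c s)" by fastforce
    with True show ?thesis
      by (intro exI[of _ "cost_test t + k + 1"]) (use run_Cond_True[of t s c k "exec c s" d] in auto)
  next
    case False
    from Cond obtain k where "k \<le> max_cost d" "run d s k (exec d s)" by fastforce
    with False show ?thesis
      by (intro exI[of _ "cost_test t + k + 1"]) (use run_Cond_False[of t s d k "exec d s" c] in auto)
  qed
qed simp

lemma ends_loop_free: "loop_free c \<Longrightarrow> Q (exec c s) \<Longrightarrow> ends c s (max_cost c) Q"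
  unfolding ends_def using run_loop_free by blast

definition count_loop :: "vname \<Rightarrow> exp \<Rightarrow> prog \<Rightarrow> prog" where
  "count_loop x e c = Seq (Assign x (Lit 0))
     (Loop (Less (Var x) e) (Seq c (Assign x (Arith Add (Var x) (Lit 1)))))"

text \<open>The invariant \<open>I\<close> is stated for the store in which the counter has already been set, so it need not
  mention the counter. The constants \<open>8\<close> and \<open>6\<close> are the costs of testing, incrementing and initializing
  it and of the commands that connect these steps.\<close>

lemma ends_count_loop:
  assumes init: "I 0 (s(Scalar x := 0))"
    and bound: "\<And>t s. I t s \<Longrightarrow> eval_exp e s = int N"
    and step: "\<And>t s. I t s \<Longrightarrow> t < N \<Longrightarrow> s (Scalar x) = int t \<Longrightarrow>
      loop_free c \<and> exec c s (Scalar x) = int t \<and> I (Suc t) ((exec c s)(Scalar x := int t + 1))"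
  shows "ends (count_loop x e c) s (N * (cost_exp e + max_cost c + 8) + cost_exp e + 6) (I N)"
proof -
  let ?b = "Less (Var x) e" and ?J = "\<lambda>t s. I t s \<and> s (Scalar x) = int t"
  let ?c = "Seq c (Assign x (Arith Add (Var x) (Lit 1)))"
  have iter: "t < N \<and> ends ?c s (max_cost c + 5) (?J (Suc t))"
    if J: "?J t s" and test: "eval_test ?b s" for t s
  proof
    show t: "t < N" using J test bound[of t s] by simp
    have "loop_free ?c" "?J (Suc t) (exec ?c s)" using step[of t s] J t by simp_all
    from ends_loop_free[where Q = "?J (Suc t)", OF this] show "ends ?c s (max_cost c + 5) (?J (Suc t))"
      by (simp add: eval_nat_numeral)
  qed
  have "ends (Loop ?b ?c) s' (N * (cost_exp e + max_cost c + 8) + cost_exp e + 3) (I N)"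
    if "?J 0 s'" for s'
  proof (rule ends_mono[OF ends_Loop[where I = ?J, OF that iter]])
    fix s' assume "\<exists>t\<le>N. ?J t s' \<and> \<not> eval_test ?b s'"
    then show "I N s'" using bound by force
  qed (simp_all add: algebra_simps)
  note loop = this
  show ?thesis unfolding count_loop_def
    by (rule ends_mono[OF ends_Seq[OF ends_Assign[where Q = "?J 0"] loop]]) (use init in simp_all)
qed

section \<open>The program\<close>

abbreviation add_exp (infixl "[+]" 65) where "a [+] b \<equiv> Arith Add a b"
abbreviation sub_exp (infixl "[-]" 65) where "a [-] b \<equiv> Arith Sub a b"
abbreviation mul_exp (infixl "[*]" 70) where "a [*] b \<equiv> Arith Mul a b"
abbreviation div_exp (infixl "[div]" 70) where "a [div] b \<equiv> Arith Div a b"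
abbreviation mod_exp (infixl "[mod]" 70) where "a [mod] b \<equiv> Arith Mod a b"
abbreviation seq_prog (infixr ";;" 55) where "c ;; d \<equiv> Seq c d"

text \<open>Arrays: \<open>W\<close> holds powers of two, \<open>P\<close> and \<open>Q\<close> the drifts of the first column and the first row
  of \<open>A\<close>, \<open>M\<close> the current candidate, and \<open>C[i,j]\<close> the sum of its entries above row \<open>i\<close> and left of
  column \<open>j\<close>. One-dimensional arrays use second index \<open>0\<close>. The initial value \<open>0\<close> of all cells supplies
  the drifts of the first block and the borders of \<open>C\<close>. The initial \<open>failure = 1\<close> makes the search
  loop start.\<close>

definition setup_scalars :: prog where
  "setup_scalars =
     Assign ''bits'' (Var ''p'' [*] Var ''q'' [*] (Lit 2 [*] Var ''q'' [+] Lit 1) [*]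
       (Lit 2 [*] Var ''p'' [+] Lit 1)) ;;
     Assign ''m'' (Var ''rows'' [+] Var ''p'' [-] Lit 1) ;;
     Assign ''n'' (Var ''cols'' [+] Var ''q'' [-] Lit 1) ;;
     Assign ''failure'' (Lit 1) ;;
     Store ''W'' (Lit 0) (Lit 0) (Lit 1)"

definition power_step :: prog where
  "power_step = Store ''W'' (Var ''k'' [+] Lit 1) (Lit 0) (Elem ''W'' (Var ''k'') (Lit 0) [*] Lit 2)"

definition row_drift_step :: prog where
  "row_drift_step = Store ''P'' (Var ''k'' [+] Var ''p'') (Lit 0)
     (Elem ''P'' (Var ''k'') (Lit 0) [+]
       (Elem ''A'' (Var ''k'' [+] Lit 1) (Lit 0) [-] Elem ''A'' (Var ''k'') (Lit 0)))"

definition col_drift_step :: prog where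
  "col_drift_step = Store ''Q'' (Var ''k'' [+] Var ''q'') (Lit 0)
     (Elem ''Q'' (Var ''k'') (Lit 0) [+]
       (Elem ''A'' (Lit 0) (Var ''k'' [+] Lit 1) [-] Elem ''A'' (Lit 0) (Var ''k'')))"

text \<open>The tuple \<open>(i mod p, j mod q, P[i] + q, Q[j] + p)\<close> read as a number in mixed radix, the last two
  digits being shifted to make them nonnegative.\<close>

definition code_exp :: exp where
  "code_exp =
     (((Var ''i'' [mod] Var ''p'') [*] Var ''q'' [+] Var ''j'' [mod] Var ''q'') [*]
         (Lit 2 [*] Var ''q'' [+] Lit 1) [+] (Elem ''P'' (Var ''i'') (Lit 0) [+] Var ''q'')) [*]
       (Lit 2 [*] Var ''p'' [+] Lit 1) [+] (Elem ''Q'' (Var ''j'') (Lit 0) [+] Var ''p'')"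

text \<open>Inclusion and exclusion on \<open>C\<close> gives the sum of the window with lower right corner \<open>(i, j)\<close>; the
  first two conditions say that there is such a window.\<close>

definition window_test :: test where
  "window_test = Conj (Leq (Var ''p'') (Var ''i'' [+] Lit 1)) (Conj (Leq (Var ''q'') (Var ''j'' [+] Lit 1))
     (Neg (Equal
       (Elem ''C'' (Var ''i'' [+] Lit 1) (Var ''j'' [+] Lit 1)
        [-] Elem ''C'' (Var ''i'' [+] Lit 1 [-] Var ''p'') (Var ''j'' [+] Lit 1)
        [-] Elem ''C'' (Var ''i'' [+] Lit 1) (Var ''j'' [+] Lit 1 [-] Var ''q'')
        [+] Elem ''C'' (Var ''i'' [+] Lit 1 [-] Var ''p'') (Var ''j'' [+] Lit 1 [-] Var ''q''))
       (Elem ''A'' (Var ''i'' [+] Lit 1 [-] Var ''p'') (Var ''j'' [+] Lit 1 [-] Var ''q'')))))"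

text \<open>The counter \<open>k\<close> runs through the positions row by row; when \<open>(i, j)\<close> is reached, all earlier entries
  of \<open>C\<close> needed for the recurrence and for the window are in place.\<close>

definition entry_step :: prog where
  "entry_step =
     Assign ''i'' (Var ''k'' [div] Var ''n'') ;;
     Assign ''j'' (Var ''k'' [mod] Var ''n'') ;;
     Store ''M'' (Var ''i'') (Var ''j'') (Var ''g'' [div] Elem ''W'' code_exp (Lit 0) [mod] Lit 2) ;;
     Store ''C'' (Var ''i'' [+] Lit 1) (Var ''j'' [+] Lit 1)
       (Elem ''C'' (Var ''i'') (Var ''j'' [+] Lit 1) [+] Elem ''C'' (Var ''i'' [+] Lit 1) (Var ''j'')
         [-] Elem ''C'' (Var ''i'') (Var ''j'') [+] Elem ''M'' (Var ''i'') (Var ''j'')) ;;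
     Cond window_test (Assign ''failure'' (Lit 1)) Skip"

definition search :: prog where
  "search = Loop (Conj (Equal (Var ''failure'') (Lit 1)) (Less (Var ''g'') (Elem ''W'' (Var ''bits'') (Lit 0))))
     (Assign ''failure'' (Lit 0) ;;
      count_loop ''k'' (Var ''m'' [*] Var ''n'') entry_step ;;
      Assign ''g'' (Var ''g'' [+] Lit 1))"

definition rec_smooth :: prog where
  "rec_smooth =
     setup_scalars ;;
     count_loop ''k'' (Var ''bits'') power_step ;;
     count_loop ''k'' (Var ''rows'' [-] Lit 1) row_drift_step ;;
     count_loop ''k'' (Var ''cols'' [-] Lit 1) col_drift_step ;;
     search"

section \<open>Correctness of the tables\<close>

locale scan_problem =
  fixes p q m' n' :: nat and A :: "int mat"
  assumes pos: "0 < p" "0 < q" "0 < m'" "0 < n'"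
    and A: "A \<in> carrier_mat m' n'"
begin

definition m :: nat where "m = m' + p - 1"
definition n :: nat where "n = n' + q - 1"
definition bits :: nat where "bits = p * q * (2 * q + 1) * (2 * p + 1)"

text \<open>The contents of \<open>W\<close> after \<open>l\<close> steps, with the default \<open>0\<close> elsewhere. Specifying all cells
  gives \<open>candidate\<close> the value that the program computes even if a code is out of range.\<close>

definition power_table :: "nat \<Rightarrow> int \<Rightarrow> int" where
  "power_table l k = (if 0 \<le> k \<and> k \<le> int l then 2 ^ nat k else 0)"

abbreviation P :: "nat \<Rightarrow> int" where "P \<equiv> drift p (\<lambda>i. A $$ (i, 0))"
abbreviation Q :: "nat \<Rightarrow> int" where "Q \<equiv> drift q (\<lambda>j. A $$ (0, j))"

definition code :: "nat \<Rightarrow> nat \<Rightarrow> int" where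
  "code i j = ((int (i mod p) * int q + int (j mod q)) * (2 * int q + 1) + (P i + int q)) * (2 * int p + 1)
     + (Q j + int p)"

definition candidate :: "nat \<Rightarrow> nat \<Rightarrow> nat \<Rightarrow> int" where
  "candidate g i j = int g div power_table bits (code i j) mod 2"

text \<open>The parameters tell how far the three tables have been filled. The array \<open>C\<close> is only required to
  vanish at its borders, as the search overwrites the rest for every candidate.\<close>

definition tables :: "nat \<Rightarrow> nat \<Rightarrow> nat \<Rightarrow> store \<Rightarrow> bool" where
  "tables l x y s \<longleftrightarrow>
     s (Scalar ''p'') = int p \<and> s (Scalar ''q'') = int q \<and>
     s (Scalar ''rows'') = int m' \<and> s (Scalar ''cols'') = int n' \<and>
     s (Scalar ''m'') = int m \<and> s (Scalar ''n'') = int n \<and> s (Scalar ''bits'') = int bits \<and>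
     (\<forall>i<m'. \<forall>j<n'. s (Entry ''A'' (int i) (int j)) = A $$ (i, j)) \<and>
     (\<forall>k. s (Entry ''W'' k 0) = power_table l k) \<and>
     (\<forall>i<p + x. s (Entry ''P'' (int i) 0) = P i) \<and>
     (\<forall>j<q + y. s (Entry ''Q'' (int j) 0) = Q j) \<and>
     (\<forall>k. s (Entry ''C'' k 0) = 0 \<and> s (Entry ''C'' 0 k) = 0)"

lemma tables_scalar [simp]:
  "\<forall>y \<in> {''p'', ''q'', ''rows'', ''cols'', ''m'', ''n'', ''bits''}. y \<noteq> x \<Longrightarrow>
     tables l a b (s(Scalar x := v)) = tables l a b s"
  by (simp add: tables_def)

definition search_fresh :: "store \<Rightarrow> bool" where
  "search_fresh s \<longleftrightarrow> s (Scalar ''g'') = 0 \<and> s (Scalar ''failure'') = 1"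

lemma search_fresh_k [simp]: "search_fresh (s(Scalar ''k'' := v)) = search_fresh s"
  by (simp add: search_fresh_def)

lemma setup_scalars_correct:
  "loop_free setup_scalars"
  "tables 0 0 0 (exec setup_scalars (input_store p q A))"
  "search_fresh (exec setup_scalars (input_store p q A))"
proof -
  show "loop_free setup_scalars" by (simp add: setup_scalars_def)
  have "int m = int m' + int p - 1" "int n = int n' + int q - 1"
    using pos by (simp_all add: m_def n_def)
  moreover have "int bits = int p * int q * (2 * int q + 1) * (2 * int p + 1)"
    by (simp add: bits_def algebra_simps)
  ultimately show "tables 0 0 0 (exec setup_scalars (input_store p q A))"
    using A by (auto simp: setup_scalars_def tables_def power_table_def)
  show "search_fresh (exec setup_scalars (input_store p q A))"
    by (simp add: setup_scalars_def search_fresh_def)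
qed

lemma power_step_correct:
  assumes "tables t 0 0 s \<and> search_fresh s" "s (Scalar ''k'') = int t"
  shows "loop_free power_step \<and> exec power_step s (Scalar ''k'') = int t \<and>
    tables (Suc t) 0 0 ((exec power_step s)(Scalar ''k'' := int t + 1)) \<and>
    search_fresh ((exec power_step s)(Scalar ''k'' := int t + 1))"
proof -
  have "power_table t (int t) * 2 = power_table (Suc t) (int t + 1)"
    by (simp add: power_table_def nat_add_distrib)
  moreover have "power_table (Suc t) k = power_table t k" if "k \<noteq> int t + 1" for k
    using that by (auto simp: power_table_def)
  ultimately show ?thesis using assms
    by (simp add: power_step_def tables_def search_fresh_def)
qed

lemma row_drift_step_correct:
  assumes "tables l t 0 s \<and> search_fresh s" "s (Scalar ''k'') = int t" "t < m' - 1"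
  shows "loop_free row_drift_step \<and> exec row_drift_step s (Scalar ''k'') = int t \<and>
    tables l (Suc t) 0 ((exec row_drift_step s)(Scalar ''k'' := int t + 1)) \<and>
    search_fresh ((exec row_drift_step s)(Scalar ''k'' := int t + 1))"
proof -
  have "s (Entry ''A'' (int t + 1) 0) = A $$ (Suc t, 0)" "s (Entry ''A'' (int t) 0) = A $$ (t, 0)"
    using assms(1) \<open>t < m' - 1\<close> pos unfolding tables_def
    by (metis less_diff_conv of_nat_0 of_nat_Suc add.commute Suc_eq_plus1 Suc_lessD)+
  moreover have "s (Entry ''P'' (int t) 0) = P t"
    using assms(1) pos unfolding tables_def by simp
  ultimately have "P (t + p) = s (Entry ''P'' (int t) 0) + (s (Entry ''A'' (int t + 1) 0) - s (Entry ''A'' (int t) 0))"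
    using drift_add[OF pos(1)] by simp
  then show ?thesis using assms
    by (auto simp: row_drift_step_def tables_def search_fresh_def less_Suc_eq add.commute)
qed

lemma col_drift_step_correct:
  assumes "tables l x t s \<and> search_fresh s" "s (Scalar ''k'') = int t" "t < n' - 1"
  shows "loop_free col_drift_step \<and> exec col_drift_step s (Scalar ''k'') = int t \<and>
    tables l x (Suc t) ((exec col_drift_step s)(Scalar ''k'' := int t + 1)) \<and>
    search_fresh ((exec col_drift_step s)(Scalar ''k'' := int t + 1))"
proof -
  have "s (Entry ''A'' 0 (int t + 1)) = A $$ (0, Suc t)" "s (Entry ''A'' 0 (int t)) = A $$ (0, t)"
    using assms(1) \<open>t < n' - 1\<close> pos unfolding tables_def
    by (metis less_diff_conv of_nat_0 of_nat_Suc add.commute Suc_eq_plus1 Suc_lessD)+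
  moreover have "s (Entry ''Q'' (int t) 0) = Q t"
    using assms(1) pos unfolding tables_def by simp
  ultimately have "Q (t + q) = s (Entry ''Q'' (int t) 0) + (s (Entry ''A'' 0 (int t + 1)) - s (Entry ''A'' 0 (int t)))"
    using drift_add[OF pos(2)] by simp
  then show ?thesis using assms
    by (auto simp: col_drift_step_def tables_def search_fresh_def less_Suc_eq add.commute)
qed

abbreviation ready :: "store \<Rightarrow> bool" where "ready \<equiv> tables bits (m' - 1) (n' - 1)"

section \<open>Correctness of the search\<close>

text \<open>The windows are indexed by their lower right corners, because that is the moment at which the
  scan through the entries knows their sums; an entry too close to the upper or left border
  completes no window, and then the condition is void.\<close>

definition corner_ok :: "nat \<Rightarrow> nat \<Rightarrow> nat \<Rightarrow> bool" where
  "corner_ok g i j \<longleftrightarrow> (p \<le> Suc i \<longrightarrow> q \<le> Suc j \<longrightarrow>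
     window p q (candidate g) (Suc i - p) (Suc j - q) = A $$ (Suc i - p, Suc j - q))"

text \<open>The first \<open>t\<close> positions, in row-major order, have been treated for the candidate \<open>g\<close>.\<close>

definition filled :: "nat \<Rightarrow> nat \<Rightarrow> store \<Rightarrow> bool" where
  "filled g t s \<longleftrightarrow> ready s \<and> s (Scalar ''g'') = int g \<and>
     (\<forall>i j. j < n \<longrightarrow> i * n + j < t \<longrightarrow>
        s (Entry ''M'' (int i) (int j)) = candidate g i j \<and>
        s (Entry ''C'' (int (Suc i)) (int (Suc j))) = area (candidate g) (Suc i) (Suc j)) \<and>
     s (Scalar ''failure'') = of_bool (\<exists>i j. j < n \<and> i * n + j < t \<and> \<not> corner_ok g i j)"

text \<open>The proof names the stores between the assignments \<open>s1\<close>, ..., \<open>s4\<close>, so that the values read by each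
  of them can be rewritten to their meaning before the next store is formed.\<close>

lemma entry_step_correct:
  assumes filled: "filled g t s" and k: "s (Scalar ''k'') = int t" and t: "t < m * n"
  shows "loop_free entry_step \<and> exec entry_step s (Scalar ''k'') = int t \<and>
    filled g (Suc t) ((exec entry_step s)(Scalar ''k'' := int t + 1))"
proof -
  define i j where "i = t div n" and "j = t mod n"
  have "0 < n" using pos by (simp add: n_def)
  then have ij: "i < m" "j < n" "t = i * n + j"
    using t div_mult_mod_eq[of t n] by (simp_all add: i_def j_def less_mult_imp_div_less)
  have new: "i' * n + j' < Suc t \<longleftrightarrow> i' * n + j' < t \<or> (i' = i \<and> j' = j)" if "j' < n" for i' j'
  proof -
    have "(i' * n + j') div n = i'" "(i' * n + j') mod n = j'" using that by simp_all
    then show ?thesis using ij(3) by (metis i_def j_def less_Suc_eq)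
  qed
  have earlier: "i' * n + j' < t" if "i' \<le> i" "j' \<le> j" "(i', j') \<noteq> (i, j)" for i' j'
  proof -
    have "i' * n \<le> i * n" using that(1) by simp
    moreover have "i' * n < i * n \<or> j' < j" using that \<open>0 < n\<close> by auto
    ultimately show ?thesis using that(2) ij(3) by linarith
  qed
  from filled have ready: "ready s" and g: "s (Scalar ''g'') = int g"
    and fail: "s (Scalar ''failure'') = of_bool (\<exists>i j. j < n \<and> i * n + j < t \<and> \<not> corner_ok g i j)"
    and old: "\<And>i j. j < n \<Longrightarrow> i * n + j < t \<Longrightarrow>
        s (Entry ''M'' (int i) (int j)) = candidate g i j \<and>
        s (Entry ''C'' (int (Suc i)) (int (Suc j))) = area (candidate g) (Suc i) (Suc j)"
    unfolding filled_def by blast+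
  have C: "s (Entry ''C'' (int x) (int y)) = area (candidate g) x y"
    if "x \<le> Suc i" "y \<le> Suc j" "(x, y) \<noteq> (Suc i, Suc j)" for x y
  proof (cases "x = 0 \<or> y = 0")
    case True
    then show ?thesis using ready by (auto simp: tables_def)
  next
    case False
    then obtain x' y' where "x = Suc x'" "y = Suc y'" by (meson not0_implies_Suc)
    then show ?thesis using that old[of y' x'] earlier[of x' y'] ij by auto
  qed
  let ?f = "candidate g"
  define s1 where "s1 = s(Scalar ''i'' := int i, Scalar ''j'' := int j)"
  define s2 where "s2 = s1(Entry ''M'' (int i) (int j) := ?f i j)"
  define s3 where "s3 = s2(Entry ''C'' (int i + 1) (int j + 1) := area ?f (Suc i) (Suc j))"
  define s4 where "s4 = (if corner_ok g i j then s3 else s3(Scalar ''failure'' := 1))"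
  have code: "eval_exp code_exp s1 = code i j"
    using ready ij pos by (simp add: code_exp_def code_def s1_def tables_def m_def n_def zmod_int)
  have "exec entry_step s = s4"
  proof -
    have n: "s (Scalar ''n'') = int n" using ready by (simp add: tables_def)
    have "exec (Assign ''j'' (Var ''k'' [mod] Var ''n'')) (exec (Assign ''i'' (Var ''k'' [div] Var ''n'')) s) = s1"
      using k n by (simp add: s1_def i_def j_def zdiv_int zmod_int)
    moreover have "exec (Store ''M'' (Var ''i'') (Var ''j'')
        (Var ''g'' [div] Elem ''W'' code_exp (Lit 0) [mod] Lit 2)) s1 = s2"
      using code g ready by (simp add: s2_def candidate_def s1_def tables_def)
    moreover have "exec (Store ''C'' (Var ''i'' [+] Lit 1) (Var ''j'' [+] Lit 1)
       (Elem ''C'' (Var ''i'') (Var ''j'' [+] Lit 1) [+] Elem ''C'' (Var ''i'' [+] Lit 1) (Var ''j'')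
         [-] Elem ''C'' (Var ''i'') (Var ''j'') [+] Elem ''M'' (Var ''i'') (Var ''j''))) s2 = s3"
      using C[of i j] C[of i "Suc j"] C[of "Suc i" j]
      by (simp add: s3_def s2_def s1_def area_Suc_Suc add.commute)
    moreover have "eval_test window_test s3 \<longleftrightarrow> \<not> corner_ok g i j"
    proof (cases "p \<le> Suc i \<and> q \<le> Suc j")
      case False
      then show ?thesis using ready
        by (auto simp: window_test_def corner_ok_def s3_def s2_def s1_def tables_def)
    next
      case True
      have C3: "s3 (Entry ''C'' (int x) (int y)) = area ?f x y" if "x \<le> Suc i" "y \<le> Suc j" for x y
      proof -
        have "int x = int i + 1 \<longleftrightarrow> x = Suc i" "int y = int j + 1 \<longleftrightarrow> y = Suc j" by auto
        then show ?thesis using C[OF that] by (auto simp: s3_def s2_def s1_def)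
      qed
      have "Suc i - p < m'" "Suc j - q < n'" using ij pos True by (auto simp: m_def n_def)
      then have A3: "s3 (Entry ''A'' (int (Suc i - p)) (int (Suc j - q))) = A $$ (Suc i - p, Suc j - q)"
        using ready by (simp add: tables_def s3_def s2_def s1_def)
      have idx: "int (Suc i) - int p = int (Suc i - p)" "int (Suc j) - int q = int (Suc j - q)"
        "int i + 1 = int (Suc i)" "int j + 1 = int (Suc j)"
        using True by auto
      have var: "s3 (Scalar ''i'') = int i" "s3 (Scalar ''j'') = int j"
        "s3 (Scalar ''p'') = int p" "s3 (Scalar ''q'') = int q"
        using ready by (simp_all add: tables_def s3_def s2_def s1_def)
      show ?thesis
        unfolding window_test_def eval_test.simps eval_exp.simps arith.simps var idx A3
          C3[OF order_refl order_refl] C3[OF diff_le_self order_refl]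
          C3[OF order_refl diff_le_self] C3[OF diff_le_self diff_le_self]
        using True by (simp add: corner_ok_def window_eq_area)
    qed
    ultimately show ?thesis
      unfolding entry_step_def exec.simps(4,5) by (simp add: s4_def)
  qed
  moreover have "filled g (Suc t) (s4(Scalar ''k'' := int t + 1))"
  proof -
    have "ready s3" using ready by (simp add: s3_def s2_def s1_def tables_def)
    then have "ready (s4(Scalar ''k'' := int t + 1))" by (simp add: s4_def)
    moreover have "(s4(Scalar ''k'' := int t + 1)) (Scalar ''g'') = int g"
      using g by (simp add: s4_def s3_def s2_def s1_def)
    moreover have "(s4(Scalar ''k'' := int t + 1)) (Entry ''M'' (int x) (int y)) = candidate g x y \<and>
        (s4(Scalar ''k'' := int t + 1)) (Entry ''C'' (int (Suc x)) (int (Suc y))) = area (candidate g) (Suc x) (Suc y)"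
      if "y < n" "x * n + y < Suc t" for x y
      using old[of y x] that new[of y x] by (auto simp: s4_def s3_def s2_def s1_def)
    moreover have "(s4(Scalar ''k'' := int t + 1)) (Scalar ''failure'')
        = of_bool (\<exists>i j. j < n \<and> i * n + j < Suc t \<and> \<not> corner_ok g i j)"
    proof (cases "corner_ok g i j")
      case True
      then have "(\<exists>i j. j < n \<and> i * n + j < Suc t \<and> \<not> corner_ok g i j) \<longleftrightarrow>
         (\<exists>i j. j < n \<and> i * n + j < t \<and> \<not> corner_ok g i j)"
        using new by metis
      then show ?thesis using True fail by (simp add: s4_def s3_def s2_def s1_def)
    next
      case False
      then have "\<exists>i j. j < n \<and> i * n + j < Suc t \<and> \<not> corner_ok g i j"
        using ij by auto
      then show ?thesis using False by (simp add: s4_def)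
    qed
    ultimately show ?thesis unfolding filled_def by blast
  qed
  moreover have "s4 (Scalar ''k'') = int t" using k by (simp add: s4_def s3_def s2_def s1_def)
  moreover have "loop_free entry_step" by (simp add: entry_step_def)
  ultimately show ?thesis by simp
qed

definition good :: "nat \<Rightarrow> bool" where
  "good g \<longleftrightarrow> (\<forall>i<m'. \<forall>j<n'. window p q (candidate g) i j = A $$ (i, j))"

lemma good_iff_corners: "good g \<longleftrightarrow> (\<forall>i<m. \<forall>j<n. corner_ok g i j)"
proof
  assume "good g"
  then show "\<forall>i<m. \<forall>j<n. corner_ok g i j"
    using pos by (auto simp: good_def corner_ok_def m_def n_def)
next
  assume corners: "\<forall>i<m. \<forall>j<n. corner_ok g i j"
  have "window p q (candidate g) i j = A $$ (i, j)" if "i < m'" "j < n'" for i j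
  proof -
    have "corner_ok g (i + p - 1) (j + q - 1)"
      using corners that pos by (simp add: m_def n_def)
    then show ?thesis using pos by (simp add: corner_ok_def)
  qed
  then show "good g" by (simp add: good_def)
qed

lemma candidate_binary: "candidate g i j \<in> {0, 1}"
  unfolding candidate_def by auto

lemma rect_scan_index:
  assumes "M \<in> carrier_mat m n" "i < m'" "j < n'"
  shows "rect_scan p q M $$ (i, j) = window p q (\<lambda>i j. M $$ (i, j)) i j"
  using assms pos by (simp add: rect_scan_def window_def m_def n_def)

lemma rect_scan_carrier: "M \<in> carrier_mat m n \<Longrightarrow> rect_scan p q M \<in> carrier_mat m' n'"
  using pos by (simp add: rect_scan_def m_def n_def)

lemma reconstruction_if_good:
  assumes "good g"
    and M: "\<And>i j. i < m \<Longrightarrow> j < n \<Longrightarrow> M $$ (i, j) = candidate g i j" "M \<in> carrier_mat m n"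
  shows "is_reconstruction p q A m n M"
  unfolding is_reconstruction_def
proof (intro conjI)
  show "binary_mat M"
    using M candidate_binary unfolding binary_mat_def elements_mat_def by fastforce
  show "rect_scan p q M = A"
  proof (rule eq_matI)
    fix i j assume "i < dim_row A" "j < dim_col A"
    then have ij: "i < m'" "j < n'" using A by auto
    have "window p q (\<lambda>i j. M $$ (i, j)) i j = window p q (candidate g) i j"
      unfolding window_def using ij pos by (intro sum.cong refl M) (auto simp: m_def n_def)
    then show "rect_scan p q M $$ (i, j) = A $$ (i, j)"
      using ij \<open>good g\<close> by (simp add: rect_scan_index[OF M(2)] good_def)
  qed (use A rect_scan_carrier[OF M(2)] in auto)
qed (fact M(2))

text \<open>Completeness of the search: the normal form of a solution is a function on codes, and its values are
  the binary digits of some \<open>g\<close>. The proof undoes the mixed radix representation digit by digit.\<close>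

lemma ex_good:
  assumes smooth: "smooth11 A" and rec: "is_reconstruction p q A m n M"
  shows "\<exists>g<2 ^ bits. good g"
proof -
  from rec have M: "M \<in> carrier_mat m n" and bin: "binary_mat M" and scan: "rect_scan p q M = A"
    by (simp_all add: is_reconstruction_def)
  obtain h where h01: "\<And>x y u v. h x y u v \<in> {0, 1 :: int}"
    and h: "\<And>i j. i < m' \<Longrightarrow> j < n' \<Longrightarrow>
      window p q (\<lambda>i j. h (i mod p) (j mod q) (P i) (Q j)) i j = A $$ (i, j)"
    and P: "\<And>i. i < m \<Longrightarrow> \<bar>P i\<bar> \<le> int q"
    and Q: "\<And>j. j < n \<Longrightarrow> \<bar>Q j\<bar> \<le> int p"
  proof (rule solution_normal_form[OF pos m_def n_def, of "\<lambda>i j. A $$ (i, j)" "\<lambda>i j. M $$ (i, j)"])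
    fix i j assume "Suc i < m'" "Suc j < n'"
    then show "A $$ (i, j) + A $$ (Suc i, Suc j) = A $$ (Suc i, j) + A $$ (i, Suc j)"
      using smooth A by (force simp: smooth11_def)
  next
    fix i j assume "i < m" "j < n"
    then show "M $$ (i, j) \<in> {0, 1}"
      using bin M by (meson binary_mat_def elements_matI subsetD)
  next
    fix i j assume "i < m'" "j < n'"
    then show "window p q (\<lambda>i j. M $$ (i, j)) i j = A $$ (i, j)"
      using rect_scan_index[OF M] scan by simp
  qed blast
  let ?X = "2 * q + 1" and ?Y = "2 * p + 1"
  define F where "F k = h (k div ?Y div ?X div q) (k div ?Y div ?X mod q)
    (int (k div ?Y mod ?X) - int q) (int (k mod ?Y) - int p)" for k
  obtain g where g: "g < 2 ^ bits" "\<And>k. k < bits \<Longrightarrow> int g div 2 ^ k mod 2 = F k"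
    using ex_nat_with_bits[of F bits] h01 unfolding F_def by blast
  have cand: "candidate g i j = h (i mod p) (j mod q) (P i) (Q j)" if ij: "i < m" "j < n" for i j
  proof -
    define u v where "u = nat (P i + int q)" and "v = nat (Q j + int p)"
    have u: "u < ?X" "int u - int q = P i" using P[OF ij(1)] by (auto simp: u_def)
    have v: "v < ?Y" "int v - int p = Q j" using Q[OF ij(2)] by (auto simp: v_def)
    define d where "d = (i mod p) * q + j mod q"
    define e where "e = d * ?X + u"
    define k where "k = e * ?Y + v"
    have d: "d div q = i mod p" "d mod q = j mod q" "d < p * q"
      using pos mixed_radix_bound[of "i mod p" p "j mod q" q] by (simp_all add: d_def)
    have e: "e div ?X = d" "e mod ?X = u" "e < p * q * ?X"
      using u(1) mixed_radix_bound[OF d(3) u(1)] unfolding e_def by (simp_all del: mult_Suc_right)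
    have k: "k div ?Y = e" "k mod ?Y = v" "k < bits"
      using v(1) mixed_radix_bound[OF e(3) v(1)] unfolding k_def bits_def by (simp_all del: mult_Suc_right)
    have "int u = P i + int q" "int v = Q j + int p" using u v by simp_all
    then have "code i j = int k"
      by (simp add: code_def k_def e_def d_def algebra_simps)
    then have "candidate g i j = F k"
      using g(2)[OF k(3)] k(3) by (simp add: candidate_def power_table_def)
    also have "F k = h (i mod p) (j mod q) (P i) (Q j)"
      unfolding F_def k(1,2) e(1,2) d(1,2) u(2) v(2) ..
    finally show ?thesis .
  qed
  have "window p q (candidate g) i j = A $$ (i, j)" if "i < m'" "j < n'" for i j
  proof -
    have "window p q (candidate g) i j = window p q (\<lambda>i j. h (i mod p) (j mod q) (P i) (Q j)) i j"
      unfolding window_def using that pos by (intro sum.cong refl cand) (auto simp: m_def n_def)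
    then show ?thesis using h[OF that] by simp
  qed
  with g(1) show ?thesis by (auto simp: good_def)
qed

text \<open>The test of the search loop ensures that \<open>failure = 0\<close> can only come from the candidate tried last,
  whose matrix is then still in \<open>M\<close>.\<close>

definition search_inv :: "nat \<Rightarrow> store \<Rightarrow> bool" where
  "search_inv t s \<longleftrightarrow> ready s \<and> s (Scalar ''g'') = int t \<and>
     (s (Scalar ''failure'') = 1 \<and> (\<forall>g<t. \<not> good g) \<or>
      s (Scalar ''failure'') = 0 \<and>
        is_reconstruction p q A m n (mat m n (\<lambda>(i, j). s (Entry ''M'' (int i) (int j)))))"

lemma filled_k [simp]: "filled g t (s(Scalar ''k'' := v)) = filled g t s"
  by (simp add: filled_def)

lemma search_inv_if_filled:
  assumes filled: "filled g (m * n) s" and before: "\<forall>g'<g. \<not> good g'"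
  shows "search_inv (Suc g) (s(Scalar ''g'' := int g + 1))"
proof -
  have range: "j < n \<and> i * n + j < m * n \<longleftrightarrow> i < m \<and> j < n" for i j
  proof (cases "j < n")
    case True
    have "i < m" if "i * n + j < m * n"
    proof -
      from that have "i * n < m * n" by linarith
      then show ?thesis by simp
    qed
    with True mixed_radix_bound[of i m j n] show ?thesis by blast
  qed simp
  have bad: "(\<exists>i j. j < n \<and> i * n + j < m * n \<and> \<not> corner_ok g i j) \<longleftrightarrow> \<not> good g"
    unfolding good_iff_corners using range by blast
  have ready: "ready s" and
    M: "\<And>i j. i < m \<Longrightarrow> j < n \<Longrightarrow> s (Entry ''M'' (int i) (int j)) = candidate g i j" and
    fail: "s (Scalar ''failure'') = of_bool (\<not> good g)"
    using filled range unfolding filled_def bad by blast+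
  show ?thesis
  proof (cases "good g")
    case True
    then have "is_reconstruction p q A m n (mat m n (\<lambda>(i, j). s (Entry ''M'' (int i) (int j))))"
      by (rule reconstruction_if_good) (simp_all add: M)
    with True ready fail show ?thesis by (simp add: search_inv_def)
  next
    case False
    with before have "\<forall>g'<Suc g. \<not> good g'" by (simp add: less_Suc_eq)
    with False ready fail show ?thesis by (simp add: search_inv_def)
  qed
qed

lemma search_correct:
  assumes smooth: "smooth11 A" and init: "ready s \<and> search_fresh s"
  shows "ends search s (2 ^ bits * (m * n * (max_cost entry_step + 11) + 27) + 10)
    (\<lambda>s'. correct_outcome p q A m n (outcome_of m n s'))"
proof -
  let ?body = "Assign ''failure'' (Lit 0) ;; count_loop ''k'' (Var ''m'' [*] Var ''n'') entry_step ;;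
      Assign ''g'' (Var ''g'' [+] Lit 1)"
  let ?test = "Conj (Equal (Var ''failure'') (Lit 1)) (Less (Var ''g'') (Elem ''W'' (Var ''bits'') (Lit 0)))"
  have test: "eval_test ?test s \<longleftrightarrow> s (Scalar ''failure'') = 1 \<and> t < 2 ^ bits" if "search_inv t s" for t s
    using that by (auto simp: search_inv_def tables_def power_table_def)
  have step: "t < 2 ^ bits \<and> ends ?body s (m * n * (max_cost entry_step + 11) + 17) (search_inv (Suc t))"
    if inv: "search_inv t s" and t: "eval_test ?test s" for t s
  proof
    show "t < 2 ^ bits" using test[OF inv] t by simp
    have before: "\<forall>g<t. \<not> good g" and ready: "ready s" and g: "s (Scalar ''g'') = int t"
      using inv test[OF inv] t by (auto simp: search_inv_def)
    have "filled t 0 (s(Scalar ''failure'' := 0))"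
      using ready g by (simp add: filled_def)
    then have 1: "ends (Assign ''failure'' (Lit 0)) s 2 (filled t 0)"
      using ends_Assign[of "filled t 0" s "''failure''" "Lit 0"] by (simp add: numeral_2_eq_2)
    have 2: "ends (count_loop ''k'' (Var ''m'' [*] Var ''n'') entry_step) s'
        (m * n * (max_cost entry_step + 11) + 9) (filled t (m * n))" if "filled t 0 s'" for s'
    proof (rule ends_mono[OF ends_count_loop[where I = "filled t" and N = "m * n"]])
      show "filled t 0 (s'(Scalar ''k'' := 0))" using that by simp
      show "\<And>u s. filled t u s \<Longrightarrow> eval_exp (Var ''m'' [*] Var ''n'') s = int (m * n)"
        by (simp add: filled_def tables_def)
    qed (use entry_step_correct in simp_all)
    have 3: "ends (Assign ''g'' (Var ''g'' [+] Lit 1)) s' 4 (search_inv (Suc t))"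
      if "filled t (m * n) s'" for s'
      using search_inv_if_filled[OF that before] that
        ends_Assign[of "search_inv (Suc t)" s' "''g''" "Var ''g'' [+] Lit 1"]
      by (simp add: filled_def eval_nat_numeral)
    show "ends ?body s (m * n * (max_cost entry_step + 11) + 17) (search_inv (Suc t))"
      by (rule ends_mono[OF ends_Seq[OF 1 ends_Seq[OF 2 3]]]) simp_all
  qed
  have start: "search_inv 0 s"
    using init by (simp add: search_inv_def search_fresh_def)
  show ?thesis
    unfolding search_def
  proof (rule ends_mono[OF ends_Loop[where I = search_inv, OF start step]])
    fix s' assume "\<exists>t\<le>2 ^ bits. search_inv t s' \<and> \<not> eval_test ?test s'"
    then obtain t where t: "t \<le> 2 ^ bits" "search_inv t s'" "\<not> eval_test ?test s'" by blast
    show "correct_outcome p q A m n (outcome_of m n s')"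
    proof (cases "s' (Scalar ''failure'') = 0")
      case True
      with t(2) show ?thesis
        by (auto simp: search_inv_def correct_outcome_def outcome_of_def)
    next
      case False
      with t(2) have failure: "s' (Scalar ''failure'') = 1" and none: "\<forall>g<t. \<not> good g"
        by (auto simp: search_inv_def)
      have "t = 2 ^ bits" using test[OF t(2)] t(1,3) failure by simp
      with none have "\<not> (\<exists>M. is_reconstruction p q A m n M)" using ex_good[OF smooth] by blast
      with failure show ?thesis by (simp add: correct_outcome_def outcome_of_def)
    qed
  qed simp_all
qed

text \<open>Generous enough for the sum of all costs, and independent of the size of \<open>A\<close>.\<close>

definition time_factor :: nat where
  "time_factor = max_cost setup_scalars + bits * (max_cost power_step + 9) + max_cost row_drift_step
     + max_cost col_drift_step + 2 ^ bits * (max_cost entry_step + 38) + 61"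

theorem rec_smooth_correct:
  assumes smooth: "smooth11 A"
  shows "ends rec_smooth (input_store p q A) (time_factor * (m * n))
    (\<lambda>s. correct_outcome p q A m n (outcome_of m n s))"
proof -
  let ?I = "\<lambda>l x y s. tables l x y s \<and> search_fresh s"
  have 1: "ends setup_scalars (input_store p q A) (max_cost setup_scalars) (?I 0 0 0)"
    using setup_scalars_correct by (intro ends_loop_free) auto
  have 2: "ends (count_loop ''k'' (Var ''bits'') power_step) s
     (bits * (max_cost power_step + 9) + 7) (?I bits 0 0)" if "?I 0 0 0 s" for s
  proof (rule ends_mono[OF ends_count_loop[where I = "\<lambda>t. ?I t 0 0" and N = bits]])
    show "?I 0 0 0 (s(Scalar ''k'' := 0))" using that by simp
    show "\<And>t s. ?I t 0 0 s \<Longrightarrow> eval_exp (Var ''bits'') s = int bits"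
      using pos by (simp add: tables_def of_nat_diff)
  qed (use power_step_correct in \<open>blast | simp\<close>)+
  have 3: "ends (count_loop ''k'' (Var ''rows'' [-] Lit 1) row_drift_step) s
     ((m' - 1) * (max_cost row_drift_step + 11) + 9) (?I bits (m' - 1) 0)" if "?I bits 0 0 s" for s
  proof (rule ends_mono[OF ends_count_loop[where I = "\<lambda>t. ?I bits t 0" and N = "m' - 1"]])
    show "?I bits 0 0 (s(Scalar ''k'' := 0))" using that by simp
    show "\<And>t s. ?I bits t 0 s \<Longrightarrow> eval_exp (Var ''rows'' [-] Lit 1) s = int (m' - 1)"
      using pos by (simp add: tables_def of_nat_diff)
  qed (use row_drift_step_correct in \<open>blast | simp\<close>)+
  have 4: "ends (count_loop ''k'' (Var ''cols'' [-] Lit 1) col_drift_step) s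
     ((n' - 1) * (max_cost col_drift_step + 11) + 9) (\<lambda>s. ready s \<and> search_fresh s)" if "?I bits (m' - 1) 0 s" for s
  proof (rule ends_mono[OF ends_count_loop[where I = "\<lambda>t. ?I bits (m' - 1) t" and N = "n' - 1"]])
    show "?I bits (m' - 1) 0 (s(Scalar ''k'' := 0))" using that by simp
    show "\<And>t s. ?I bits (m' - 1) t s \<Longrightarrow> eval_exp (Var ''cols'' [-] Lit 1) s = int (n' - 1)"
      using pos by (simp add: tables_def of_nat_diff)
  qed (use col_drift_step_correct in \<open>blast | simp\<close>)+
  \<comment> \<open>Every term of the total cost is absorbed by a multiple of \<open>w\<close>, as \<open>w \<ge> 1\<close> bounds both table lengths.\<close>
  define w where "w = m * n"
  have w: "1 \<le> w" "m' - 1 \<le> w" "n' - 1 \<le> w"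
  proof -
    have mn: "1 \<le> m" "1 \<le> n" "m' - 1 \<le> m" "n' - 1 \<le> n" using pos by (auto simp: m_def n_def)
    then have "m \<le> w" "n \<le> w" by (auto simp: w_def)
    with mn show "1 \<le> w" "m' - 1 \<le> w" "n' - 1 \<le> w" by linarith+
  qed
  have le: "x \<le> x * w" for x using w(1) by simp
  show ?thesis
    unfolding rec_smooth_def
  proof (rule ends_mono[OF ends_Seq[OF 1 ends_Seq[OF 2 ends_Seq[OF 3 ends_Seq[OF 4 search_correct[OF smooth]]]]]])
    define a b c d e where "a = max_cost setup_scalars" "b = bits * (max_cost power_step + 9)"
      "c = max_cost row_drift_step" "d = max_cost col_drift_step" "e = max_cost entry_step"
    have "(m' - 1) * (c + 11) \<le> w * (c + 11)" "(n' - 1) * (d + 11) \<le> w * (d + 11)"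
      by (fact mult_le_mono1[OF w(2)] mult_le_mono1[OF w(3)])+
    then have "(m' - 1) * (c + 11) \<le> c * w + 11 * w" "(n' - 1) * (d + 11) \<le> d * w + 11 * w"
      by (simp_all only: distrib_left mult.commute)
    moreover have "2 ^ bits * (w * (e + 11) + 27) \<le> 2 ^ bits * (e + 38) * w"
      using w(1) by (simp add: algebra_simps)
    moreover note le[of a] le[of b] w(1)
    moreover have "time_factor * w
        = a * w + b * w + c * w + d * w + 2 ^ bits * (e + 38) * w + 61 * w"
      unfolding time_factor_def a_b_c_d_e_def[symmetric] by (simp only: distrib_right)
    ultimately show "max_cost setup_scalars + (bits * (max_cost power_step + 9) + 7 +
        ((m' - 1) * (max_cost row_drift_step + 11) + 9 +
        ((n' - 1) * (max_cost col_drift_step + 11) + 9 +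
        (2 ^ bits * (m * n * (max_cost entry_step + 11) + 27) + 10) + 1) + 1) + 1) + 1
      \<le> time_factor * (m * n)"
      unfolding a_b_c_d_e_def[symmetric] w_def[symmetric] by linarith
  qed
qed

end

text \<open>The polynomial is \<open>K * m * n\<close>: the outer variable is evaluated at \<open>m\<close>, the inner one at \<open>n\<close>.\<close>

theorem theorem18:
  shows "\<exists>RecSmooth :: prog.
    \<forall>p q :: nat. 1 \<le> p \<longrightarrow> 1 \<le> q \<longrightarrow>
      (\<exists>P :: nat poly poly. \<forall>m' n' m n :: nat. \<forall>A :: int mat.
        1 \<le> m' \<longrightarrow> 1 \<le> n' \<longrightarrow> A \<in> carrier_mat m' n' \<longrightarrow> smooth11 A \<longrightarrow>
        m = m' + p - 1 \<longrightarrow> n = n' + q - 1 \<longrightarrow>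
        (\<exists>k s. run RecSmooth (input_store p q A) k s \<and>
               correct_outcome p q A m n (outcome_of m n s) \<and>
               k \<le> poly (poly P [:m:]) n))"
proof (intro exI[of _ rec_smooth] allI impI)
  fix p q :: nat assume pq: "1 \<le> p" "1 \<le> q"
  define K where "K = scan_problem.time_factor p q"
  show "\<exists>P :: nat poly poly. \<forall>m' n' m n :: nat. \<forall>A :: int mat.
        1 \<le> m' \<longrightarrow> 1 \<le> n' \<longrightarrow> A \<in> carrier_mat m' n' \<longrightarrow> smooth11 A \<longrightarrow>
        m = m' + p - 1 \<longrightarrow> n = n' + q - 1 \<longrightarrow>
        (\<exists>k s. run rec_smooth (input_store p q A) k s \<and>
               correct_outcome p q A m n (outcome_of m n s) \<and>
               k \<le> poly (poly P [:m:]) n)"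
  proof (intro exI[of _ "[:0, [:0, K:]:]"] allI impI)
    fix m' n' m n :: nat and A :: "int mat"
    assume size: "1 \<le> m'" "1 \<le> n'" "A \<in> carrier_mat m' n'" and smooth: "smooth11 A"
      and mn: "m = m' + p - 1" "n = n' + q - 1"
    interpret scan_problem p q m' n' A
      using pq size by unfold_locales auto
    have "poly (poly [:0, [:0, K:]:] [:m:]) n = K * (m * n)"
      by simp
    moreover have "m = scan_problem.m p m'" "n = scan_problem.n q n'"
      using mn by (simp_all add: m_def n_def)
    ultimately show "\<exists>k s. run rec_smooth (input_store p q A) k s \<and>
               correct_outcome p q A m n (outcome_of m n s) \<and>
               k \<le> poly (poly [:0, [:0, K:]:] [:m:]) n"
      using rec_smooth_correct[OF smooth] unfolding ends_def K_def by (auto simp: mult_ac)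
  qed
qed

end
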